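(* Consider the plant $x(k+1)=f(x(k),u(k))$, $k\in\mathbb{N}_0$. Suppose that Assumptions 1, 2 and 3 (listed in the context) hold and that the baseline algorithm $$u(k)=\begin{cases}\kappa(x(k)) & \text{if } N(k)\in\mathbb{N}_1^\Lambda,\\ \mathbf{0}_p & \text{if } N(k)=0,\end{cases}$$ is used. If $$\Theta=\alpha\sum_{j\in\mathbb{N}}\mathbf{Pr}\{\tau_i=j\}\,\rho^{j-1}<1,$$ where $\{\tau_i\}$ are the (i.i.d.) first return times of $\{N(k)\}$ to state $0$, then the control loop is stochastically stable. In particular, $$\sum_{k=0}^{\infty}\mathbf{E}\{\varphi_1(|x(k)|)\}< \frac{1+\alpha-\rho}{(1-\Theta)(1-\rho)}\,\mathbf{E}\{\varphi_2(|x(0)|)\}.$$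
   Context: Notation: $\mathbb{N}=\{1,2,\dots\}$, $\mathbb{N}_0=\mathbb{N}\cup\{0\}$, $\mathbb{N}_n^m=\{n,\dots,m\}$; $|\cdot|$ is the Euclidean norm; $\mathbf{0}_p$ is the zero vector of $\mathbb{R}^p$; $0^0=1$. A function $\varphi:\mathbb{R}_{\ge0}\to\mathbb{R}_{\ge0}$ is of class $\mathscr{K}_\infty$ if it is continuous, zero at zero, strictly increasing and unbounded. $\Lambda\ge 2$ is a fixed integer. Plant: $x(k)\in\mathbb{R}^n$, $u(k)\in\mathbb{R}^p$, $f(\mathbf{0}_n,\mathbf{0}_p)=\mathbf{0}_n$. The initial state $x(0)$ is arbitrary (subject to the moment condition in Assumption 3). Assumption 1: there exist $V:\mathbb{R}^n\to\mathbb{R}_{\ge0}$, $\varphi_1,\varphi_2\in\mathscr{K}_\infty$, a constant $\rho\in[0,1)$ and a control policy $\kappa:\mathbb{R}^n\to\mathbb{R}^p$ such that for all $x\in\mathbb{R}^n$: $\varphi_1(|x|)\le V(x)\le\varphi_2(|x|)$ and $V(f(x,\kappa(x)))\le\rho V(x)$. Assumption 2: $\{N(k)\}_{k\in\mathbb{N}_0}$, with values in $\mathbb{N}_0^\Lambda$, is a homogeneous Markov chain with $N(0)=0$ and irreducible aperiodic transition matrix $\mathcal{Q}=[q_{ij}]_{i,j\in\mathbb{N}_0^\Lambda}$, $q_{ij}=\mathbf{Pr}\{N(k+1)=j\mid N(k)=i\}$. ($N(k)$ describes the processor availability at time $k$.) Assumption 3: there exists $\alpha\in\mathbb{R}_{\ge0}$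 such that $V(f(x,\mathbf{0}_p))\le\alpha V(x)$ for all $x\in\mathbb{R}^n$, and $\mathbf{E}\{\varphi_2(|x(0)|)\}<\infty$. Return times: $t_0=0$, $t_{i+1}=\inf\{k\in\mathbb{N}: k>t_i,\ N(k)=0\}$, $\tau_i=t_{i+1}-t_i$, $i\in\mathbb{N}_0$. The $\tau_i$ are i.i.d., so $\mathbf{Pr}\{\tau_i=j\}$ does not depend on $i$. Stochastic stability: a dynamical system with state trajectory $\{x(k)\}$ is stochastically stable if $\sum_{k=0}^\infty\mathbf{E}\{\varphi(|x(k)|)\}<\infty$ for some $\varphi\in\mathscr{K}_\infty$.
   Formalization: The initial state x(0) is assumed independent of the process {N(k)} (the claim fails otherwise); the bound is proved with ≤ in general, and with strict < when Θ>0 and x(0) is not almost surely zero (strictness can fail otherwise). *)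

theory Defs
  imports "HOL-Probability.Probability" "Jordan_Normal_Form.Matrix"
begin

text \<open>Functions of class \<open>\<K>\<^sub>\<infinity>\<close> are represented by functions on all of \<^typ>\<open>real\<close>; only their
  values on \<open>{0..}\<close> matter.\<close>

definition class_K_inf :: "(real \<Rightarrow> real) set" where
  "class_K_inf = {\<phi>. \<phi> \<in> {0..} \<rightarrow> {0..} \<and> continuous_on {0..} \<phi> \<and> \<phi> 0 = 0 \<and>
     strict_mono_on {0..} \<phi> \<and> \<not> bdd_above (\<phi> ` {0..})}"

definition stochastic_matrix :: "nat \<Rightarrow> real mat \<Rightarrow> bool" where
  "stochastic_matrix m Q \<longleftrightarrow> Q \<in> carrier_mat m m \<and>
     (\<forall>i<m. \<forall>j<m. 0 \<le> Q $$ (i, j)) \<and> (\<forall>i<m. (\<Sum>j<m. Q $$ (i, j)) = 1)"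

definition irreducible_matrix :: "nat \<Rightarrow> real mat \<Rightarrow> bool" where
  "irreducible_matrix m Q \<longleftrightarrow> (\<forall>i<m. \<forall>j<m. \<exists>n\<ge>1. 0 < (Q ^\<^sub>m n) $$ (i, j))"

definition aperiodic_matrix :: "nat \<Rightarrow> real mat \<Rightarrow> bool" where
  "aperiodic_matrix m Q \<longleftrightarrow> (\<forall>i<m. Gcd {n. 1 \<le> n \<and> 0 < (Q ^\<^sub>m n) $$ (i, i)} = 1)"

text \<open>A homogeneous Markov chain on the states \<open>{0..<m}\<close>. The conditional probability is
  prescribed only on histories of positive probability; elsewhere \<^const>\<open>cond_prob\<close> is a
  division by zero.\<close>

definition markov_chain :: "'w measure \<Rightarrow> nat \<Rightarrow> real mat \<Rightarrow> (nat \<Rightarrow> 'w \<Rightarrow> nat) \<Rightarrow> bool" where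
  "markov_chain M m Q N \<longleftrightarrow> stochastic_matrix m Q \<and>
     (\<forall>k. N k \<in> measurable M (count_space {..<m})) \<and>
     (\<forall>k h. \<forall>j<m. 0 < \<P>(\<omega> in M. \<forall>l\<le>k. N l \<omega> = h l) \<longrightarrow>
        \<P>(\<omega> in M. N (Suc k) \<omega> = j \<bar> \<forall>l\<le>k. N l \<omega> = h l) = Q $$ (h k, j))"

text \<open>Return times live in \<^typ>\<open>enat\<close>: the infimum of the empty set is \<open>\<infinity>\<close>, and
  \<open>\<infinity> - t = \<infinity>\<close>, so a missing return never contributes to \<open>\<tau>\<^sub>i = j\<close> with \<open>j\<close> finite.\<close>

primrec ret_time :: "(nat \<Rightarrow> 'w \<Rightarrow> nat) \<Rightarrow> nat \<Rightarrow> 'w \<Rightarrow> enat" where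
  "ret_time N 0 \<omega> = 0"
| "ret_time N (Suc i) \<omega> = Inf {enat k | k. ret_time N i \<omega> < enat k \<and> N k \<omega> = 0}"

definition inter_ret_time :: "(nat \<Rightarrow> 'w \<Rightarrow> nat) \<Rightarrow> nat \<Rightarrow> 'w \<Rightarrow> enat" where
  "inter_ret_time N i \<omega> = ret_time N (Suc i) \<omega> - ret_time N i \<omega>"

definition contraction_factor ::
  "'w measure \<Rightarrow> (nat \<Rightarrow> 'w \<Rightarrow> nat) \<Rightarrow> real \<Rightarrow> real \<Rightarrow> nat \<Rightarrow> real" where
  "contraction_factor M N \<alpha> \<rho> i =
     \<alpha> * (\<Sum>\<^sub>\<infinity>j\<in>{1..}. \<P>(\<omega> in M. inter_ret_time N i \<omega> = enat j) * \<rho> ^ (j - 1))"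

text \<open>Expectations of nonnegative variables are taken in \<open>[0, \<infinity>]\<close>, so that no integrability
  has to be presupposed.\<close>

definition total_cost :: "'w measure \<Rightarrow> (real \<Rightarrow> real) \<Rightarrow> (nat \<Rightarrow> 'w \<Rightarrow> real ^ 'n) \<Rightarrow> ennreal" where
  "total_cost M \<phi> x = (\<Sum>k. \<integral>\<^sup>+ \<omega>. ennreal (\<phi> (norm (x k \<omega>))) \<partial>M)"

definition stochastically_stable :: "'w measure \<Rightarrow> (nat \<Rightarrow> 'w \<Rightarrow> real ^ 'n) \<Rightarrow> bool" where
  "stochastically_stable M x \<longleftrightarrow> (\<exists>\<phi>\<in>class_K_inf. total_cost M \<phi> x < \<infinity>)"

end

theory Submission imports Defs begin

text \<open>
  Along every path the Lyapunov function loses a factor \<open>\<rho>\<close> when the processor is available and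
  gains at most a factor \<open>\<alpha>\<close> when it is not, so \<open>V (x k) \<le> W\<^sub>k * V (x 0)\<close>, where \<open>W\<^sub>k\<close>
  (\<open>gain\<close>) is a product of such factors that depends on the chain alone. As the chain is
  independent of \<open>x 0\<close>, the cost is at most \<open>(\<Sum>k. E W\<^sub>k) * E \<phi>\<^sub>2 (norm (x 0))\<close>, and it
  remains to sum the series \<open>E W\<^sub>k\<close>.

  This series can be summed exactly. Let \<open>v k\<close> be the mean of \<open>W\<^sub>k\<close> on the event that the chain
  is at 0 at time \<open>k\<close>. Splitting at the last earlier visit to 0 and using the Markov property
  there, \<open>v\<close> satisfies the renewal equation \<open>v (Suc k) = (\<Sum>l\<le>k. v l * c (k - l))\<close> with
  \<open>c j = \<alpha> * \<rho> ^ j * f j\<close>, where \<open>f j\<close> is the probability that the first return to 0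
  takes \<open>j + 1\<close> steps (\<open>mean_gain_at_0_Suc\<close>). The weights \<open>c\<close> have total mass \<open>\<Theta>\<close>, so
  \<open>v\<close> sums to \<open>1 / (1 - \<Theta>)\<close> by \<open>renewal_sums\<close>. One step of the chain gives
  \<open>E W\<^sub>k\<^sub>+\<^sub>1 = \<rho> * E W\<^sub>k + (\<alpha> - \<rho>) * v k\<close>, hence
  \<open>(\<Sum>k. E W\<^sub>k) = (1 + \<alpha> - \<rho> - \<Theta>) / ((1 - \<Theta>) * (1 - \<rho>))\<close> (\<open>mean_gain_sums\<close>). The
  summand \<open>- \<Theta>\<close> in the numerator is what makes the final inequality strict when \<open>\<Theta> > 0\<close>
  and \<open>x 0\<close> is not almost surely zero.

  The number \<open>\<Theta>\<close> is given through an arbitrary inter-return time \<open>\<tau>\<^sub>i\<close>. To identify the law of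
  \<open>\<tau>\<^sub>i\<close> with \<open>f\<close> the chain must return to 0 almost surely \<open>i\<close> times. That follows from
  irreducibility by a maximum principle on the finite state space (\<open>first_passage_sums_1\<close>).
\<close>

section \<open>Two recursions for series\<close>

text \<open>Summing the renewal equation gives \<open>A = 1 + A * \<Theta>\<close> for the total \<open>A\<close> of \<open>v\<close>, by the
  Cauchy product. That needs the convergence of \<open>v\<close> first, which comes from the same computation
  with inequalities for partial sums: \<open>A\<^sub>n \<le> 1 + A\<^sub>n * \<Theta>\<close>.\<close>

lemma renewal_sums:
  fixes v c :: "nat \<Rightarrow> real"
  assumes c: "\<And>j. 0 \<le> c j" "c sums \<Theta>" "\<Theta> < 1"
    and v: "\<And>k. 0 \<le> v k" "v 0 = 1" "\<And>k. v (Suc k) = (\<Sum>l\<le>k. v l * c (k - l))"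
  shows "v sums (1 / (1 - \<Theta>))"
proof -
  have c_le: "(\<Sum>j\<in>J. c j) \<le> \<Theta>" if "finite J" for J
    using sum_le_suminf[OF sums_summable[OF c(2)] that] c(1) sums_unique[OF c(2)] by simp
  have "(\<Sum>k\<le>n. v k) \<le> 1 / (1 - \<Theta>)" for n
  proof -
    have "(\<Sum>k\<le>n. v k) \<le> (\<Sum>k\<le>Suc n. v k)"
      using v(1) by simp
    also have "\<dots> = 1 + (\<Sum>k\<le>n. \<Sum>l\<le>k. v l * c (k - l))"
      by (simp only: sum.atMost_Suc_shift v(2,3))
    also have "(\<Sum>k\<le>n. \<Sum>l\<le>k. v l * c (k - l)) = (\<Sum>l\<le>n. \<Sum>k=l..n. v l * c (k - l))"
      by (induction n) (simp_all add: sum.distrib)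
    also have "\<dots> \<le> (\<Sum>l\<le>n. v l * \<Theta>)"
    proof (intro sum_mono)
      fix l
      have "(\<Sum>k=l..n. c (k - l)) = (\<Sum>j\<in>(\<lambda>k. k - l) ` {l..n}. c j)"
        by (subst sum.reindex) (auto simp: inj_on_def)
      also have "\<dots> \<le> \<Theta>" by (rule c_le) simp
      finally show "(\<Sum>k=l..n. v l * c (k - l)) \<le> v l * \<Theta>"
        by (simp add: sum_distrib_left[symmetric] mult_left_mono v(1))
    qed
    finally have "(\<Sum>k\<le>n. v k) \<le> 1 + (\<Sum>k\<le>n. v k) * \<Theta>"
      by (simp add: sum_distrib_right)
    then show ?thesis
      using c(3) by (simp add: field_simps)
  qed
  then have sv: "summable v"
    by (intro bounded_imp_summable[where B = "1 / (1 - \<Theta>)"] v(1))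
  have "(\<lambda>k. \<Sum>l\<le>k. v l * c (k - l)) sums ((\<Sum>k. v k) * (\<Sum>k. c k))"
    using sv c(1,2) v(1) by (intro Cauchy_product_sums) (auto simp: sums_iff)
  then have "(\<lambda>k. v (Suc k)) sums ((\<Sum>k. v k) * \<Theta>)"
    using c(2) by (simp add: v(3) sums_iff)
  then have "v sums ((\<Sum>k. v k) * \<Theta> + 1)"
    by (simp add: sums_Suc_iff v(2))
  with sv have "(\<Sum>k. v k) = (\<Sum>k. v k) * \<Theta> + 1"
    by (simp add: sums_iff)
  then have "(\<Sum>k. v k) * (1 - \<Theta>) = 1"
    unfolding right_diff_distrib by linarith
  then have "(\<Sum>k. v k) = 1 / (1 - \<Theta>)"
    using c(3) by (subst nonzero_eq_divide_eq) auto
  with summable_sums[OF sv] show ?thesis by simp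
qed

text \<open>Unrolling the recursion writes \<open>s\<close> as a geometric sequence plus \<open>d\<close> times the Cauchy product
  of \<open>v\<close> with a geometric series. The sign of \<open>d\<close> is arbitrary, because in the application
  \<open>d = \<alpha> - \<rho>\<close>.\<close>

lemma geometric_recursion_sums:
  fixes s v :: "nat \<Rightarrow> real"
  assumes \<rho>: "0 \<le> \<rho>" "\<rho> < 1" and v: "\<And>k. 0 \<le> v k" "v sums A"
    and s: "\<And>k. s (Suc k) = \<rho> * s k + d * v k"
  shows "s sums ((s 0 + d * A) / (1 - \<rho>))"
proof -
  have rep: "s (Suc k) = \<rho> * (s 0 * \<rho> ^ k) + d * (\<Sum>l\<le>k. v l * \<rho> ^ (k - l))" for k
  proof (induction k)
    case 0
    then show ?case by (simp add: s)
  next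
    case (Suc k)
    have "(\<Sum>l\<le>Suc k. v l * \<rho> ^ (Suc k - l)) = \<rho> * (\<Sum>l\<le>k. v l * \<rho> ^ (k - l)) + v (Suc k)"
      by (simp add: sum_distrib_left Suc_diff_le mult_ac)
    then show ?case
      by (subst s) (simp add: Suc algebra_simps)
  qed
  have "(\<lambda>k. \<Sum>l\<le>k. v l * \<rho> ^ (k - l)) sums ((\<Sum>k. v k) * (\<Sum>k. \<rho> ^ k))"
    using v \<rho> by (intro Cauchy_product_sums) (auto simp: sums_iff summable_geometric)
  then have "(\<lambda>k. \<Sum>l\<le>k. v l * \<rho> ^ (k - l)) sums (A * (1 / (1 - \<rho>)))"
    using v(2) \<rho> by (simp add: sums_iff suminf_geometric)
  then have "(\<lambda>k. s (Suc k)) sums (\<rho> * (s 0 * (1 / (1 - \<rho>))) + d * (A * (1 / (1 - \<rho>))))"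
    unfolding rep using \<rho> by (intro sums_add sums_mult geometric_sums) auto
  then have "s sums (\<rho> * (s 0 * (1 / (1 - \<rho>))) + d * (A * (1 / (1 - \<rho>))) + s 0)"
    by (simp add: sums_Suc_iff)
  also have "\<rho> * (s 0 * (1 / (1 - \<rho>))) + d * (A * (1 / (1 - \<rho>))) + s 0 = (s 0 + d * A) / (1 - \<rho>)"
  proof (subst nonzero_eq_divide_eq)
    show nz: "1 - \<rho> \<noteq> 0" using \<rho>(2) by simp
    then have inv: "1 / (1 - \<rho>) * (1 - \<rho>) = 1" by simp
    show "(\<rho> * (s 0 * (1 / (1 - \<rho>))) + d * (A * (1 / (1 - \<rho>))) + s 0) * (1 - \<rho>) = s 0 + d * A"
      by (simp only: distrib_right mult.assoc inv) (simp add: algebra_simps)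
  qed
  finally show ?thesis .
qed

section \<open>Functionals of the past and the Markov property\<close>

text \<open>Functionals of the past are handled as functions of a deterministic path that look only at
  the coordinates up to \<open>k\<close>. The state space is finite, so such a functional of the chain takes
  finitely many values, and conditional expectations reduce to finite sums over histories.\<close>

definition adapted :: "nat \<Rightarrow> ((nat \<Rightarrow> nat) \<Rightarrow> 'a) \<Rightarrow> bool" where
  "adapted k F \<longleftrightarrow> (\<forall>h h'. (\<forall>l\<le>k. h l = h' l) \<longrightarrow> F h = F h')"

lemma adaptedD: "adapted k F \<Longrightarrow> (\<And>l. l \<le> k \<Longrightarrow> h l = h' l) \<Longrightarrow> F h = F h'"
  by (auto simp: adapted_def)

lemma adapted_mono: "adapted k F \<Longrightarrow> k \<le> l \<Longrightarrow> adapted l F"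
  unfolding adapted_def by (meson le_trans)

definition first_zero_after :: "nat \<Rightarrow> nat \<Rightarrow> (nat \<Rightarrow> nat) \<Rightarrow> bool" where
  "first_zero_after l k h \<longleftrightarrow> l < k \<and> (\<forall>r\<in>{l<..<k}. h r \<noteq> 0) \<and> h k = 0"

lemma adapted_first_zero_after: "adapted k (first_zero_after l k)"
  by (auto simp: adapted_def first_zero_after_def)

lemma adapted_of_bool: "adapted k P \<Longrightarrow> adapted k (\<lambda>h. of_bool (P h))"
  unfolding adapted_def by (intro allI impI arg_cong[where f = of_bool]) blast

lemma adapted_conj: "adapted k P \<Longrightarrow> adapted k P' \<Longrightarrow> adapted k (\<lambda>h. P h \<and> P' h)"
  unfolding adapted_def by (intro allI impI arg_cong2[where f = "(\<and>)"]) blast+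

lemma adapted_mult: "adapted k F \<Longrightarrow> adapted k G \<Longrightarrow> adapted k (\<lambda>h. F h * G h)"
  unfolding adapted_def by (intro allI impI arg_cong2[where f = "(*)"]) blast+

lemma adapted_at: "l \<le> k \<Longrightarrow> adapted k (\<lambda>h. c (h l))"
  by (simp add: adapted_def)

locale chain_from_0 = prob_space M for M :: "'w measure" +
  fixes m :: nat and Q :: "real mat" and N :: "nat \<Rightarrow> 'w \<Rightarrow> nat"
  assumes chain: "markov_chain M m Q N"
    and start: "\<And>\<omega>. \<omega> \<in> space M \<Longrightarrow> N 0 \<omega> = 0"
begin

lemma N_measurable [measurable]: "N k \<in> measurable M (count_space {..<m})"
  using chain by (auto simp: markov_chain_def)

lemma N_less: "\<omega> \<in> space M \<Longrightarrow> N k \<omega> < m"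
  using measurable_space[OF N_measurable] by fastforce

lemma m_pos: "0 < m"
  using not_empty N_less by fastforce

lemma Q_nonneg: "a < m \<Longrightarrow> b < m \<Longrightarrow> 0 \<le> Q $$ (a, b)"
  and Q_row: "a < m \<Longrightarrow> (\<Sum>b<m. Q $$ (a, b)) = 1"
  and Q_carrier: "Q \<in> carrier_mat m m"
  using chain by (auto simp: markov_chain_def stochastic_matrix_def)

abbreviation sample_path :: "'w \<Rightarrow> nat \<Rightarrow> nat" where
  "sample_path \<omega> \<equiv> \<lambda>k. N k \<omega>"

definition histories :: "nat \<Rightarrow> (nat \<Rightarrow> nat) set" where
  "histories k = PiE {..k} (\<lambda>_. {..<m})"

definition cylinder :: "nat \<Rightarrow> (nat \<Rightarrow> nat) \<Rightarrow> 'w set" where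
  "cylinder k h = {\<omega> \<in> space M. \<forall>l\<le>k. N l \<omega> = h l}"

lemma finite_histories: "finite (histories k)"
  unfolding histories_def by (intro finite_PiE) auto

lemma state_sets [measurable]: "{\<omega> \<in> space M. N k \<omega> = a} \<in> sets M"
proof -
  have "{\<omega> \<in> space M. N k \<omega> = a} = N k -` ({a} \<inter> {..<m}) \<inter> space M"
    using N_less by auto
  also have "\<dots> \<in> sets M"
    by (rule measurable_sets[OF N_measurable]) simp
  finally show ?thesis .
qed

lemma cylinder_sets [measurable]: "cylinder k h \<in> sets M"
proof -
  have "{\<omega> \<in> space M. \<forall>l\<in>{..k}. N l \<omega> = h l} \<in> sets M"
    by (intro sets.sets_Collect_finite_All' state_sets) auto
  then show ?thesis by (simp add: cylinder_def)
qed

text \<open>The cylinders of the histories up to time \<open>k\<close> partition the space, and \<open>F\<close> is constant on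
  each of them.\<close>

lemma history_expansion:
  fixes F :: "(nat \<Rightarrow> nat) \<Rightarrow> real"
  assumes F: "adapted k F" and \<omega>: "\<omega> \<in> space M"
  shows "F (sample_path \<omega>) = (\<Sum>h\<in>histories k. F h * indicator (cylinder k h) \<omega>)"
proof -
  let ?h = "restrict (sample_path \<omega>) {..k}"
  have h: "?h \<in> histories k"
    using N_less[OF \<omega>] by (auto simp: histories_def)
  have "indicator (cylinder k h) \<omega> = (if h = ?h then 1 else 0 :: real)" if "h \<in> histories k" for h
  proof (cases "h = ?h")
    case True
    then show ?thesis using \<omega> by (auto simp: cylinder_def)
  next
    case False
    have "\<omega> \<notin> cylinder k h"
    proof
      assume "\<omega> \<in> cylinder k h"
      with that have "h = ?h"
        by (intro PiE_ext[of h "{..k}" "\<lambda>_. {..<m}"])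
           (use h in \<open>auto simp: histories_def cylinder_def\<close>)
      with False show False ..
    qed
    with False show ?thesis by simp
  qed
  then have "(\<Sum>h\<in>histories k. F h * indicator (cylinder k h) \<omega>)
    = (\<Sum>h\<in>histories k. if h = ?h then F h else 0)"
    by (intro sum.cong) auto
  also have "\<dots> = F ?h"
    using h finite_histories by simp
  also have "\<dots> = F (sample_path \<omega>)"
    by (rule adaptedD[OF F]) simp
  finally show ?thesis ..
qed

lemma integral_history:
  fixes F :: "(nat \<Rightarrow> nat) \<Rightarrow> real"
  assumes F: "adapted k F"
  shows "integrable M (\<lambda>\<omega>. F (sample_path \<omega>))"
    and "expectation (\<lambda>\<omega>. F (sample_path \<omega>)) = (\<Sum>h\<in>histories k. F h * prob (cylinder k h))"
proof -
  have eq: "(\<Sum>h\<in>histories k. F h * indicator (cylinder k h) \<omega>) = F (sample_path \<omega>)"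
    if "\<omega> \<in> space M" for \<omega>
    using history_expansion[OF F that] by simp
  have i: "integrable M (\<lambda>\<omega>. \<Sum>h\<in>histories k. F h * indicator (cylinder k h) \<omega>)"
    by (intro Bochner_Integration.integrable_sum integrable_mult_right) (simp add: emeasure_eq_measure)
  show "integrable M (\<lambda>\<omega>. F (sample_path \<omega>))"
    using i by (simp add: eq cong: Bochner_Integration.integrable_cong)
  have "expectation (\<lambda>\<omega>. F (sample_path \<omega>))
      = expectation (\<lambda>\<omega>. \<Sum>h\<in>histories k. F h * indicator (cylinder k h) \<omega>)"
    by (intro Bochner_Integration.integral_cong) (simp_all add: eq)
  also have "\<dots> = (\<Sum>h\<in>histories k. F h * prob (cylinder k h))"
    by (subst Bochner_Integration.integral_sum) (auto simp: emeasure_eq_measure)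
  finally show "expectation (\<lambda>\<omega>. F (sample_path \<omega>)) = (\<Sum>h\<in>histories k. F h * prob (cylinder k h))" .
qed

text \<open>A cylinder of probability zero, where the conditional probability carries no information,
  makes both sides vanish.\<close>

lemma prob_cylinder_step:
  assumes j: "j < m"
  shows "prob (cylinder k h \<inter> {\<omega> \<in> space M. N (Suc k) \<omega> = j}) = prob (cylinder k h) * Q $$ (h k, j)"
proof (cases "0 < prob (cylinder k h)")
  case True
  then have "\<P>(\<omega> in M. N (Suc k) \<omega> = j \<bar> \<forall>l\<le>k. N l \<omega> = h l) = Q $$ (h k, j)"
    using chain j by (simp add: markov_chain_def cylinder_def)
  moreover have "{\<omega> \<in> space M. N (Suc k) \<omega> = j \<and> (\<forall>l\<le>k. N l \<omega> = h l)}
    = cylinder k h \<inter> {\<omega> \<in> space M. N (Suc k) \<omega> = j}"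
    by (auto simp: cylinder_def)
  ultimately show ?thesis
    using True by (simp add: cond_prob_def cylinder_def[symmetric] field_simps)
next
  case False
  then have z: "prob (cylinder k h) = 0"
    using measure_nonneg[of M "cylinder k h"] by linarith
  have "prob (cylinder k h \<inter> {\<omega> \<in> space M. N (Suc k) \<omega> = j}) \<le> prob (cylinder k h)"
    by (intro finite_measure_mono) auto
  with z show ?thesis
    using measure_nonneg[of M "cylinder k h \<inter> {\<omega> \<in> space M. N (Suc k) \<omega> = j}"] by simp
qed

text \<open>The Markov property in integrated form: conditionally on the past, \<open>G\<close> of the next state may
  be replaced by its one-step mean.\<close>

lemma markov_step:
  fixes F :: "(nat \<Rightarrow> nat) \<Rightarrow> real" and G :: "nat \<Rightarrow> real"
  assumes F: "adapted k F"
  shows "expectation (\<lambda>\<omega>. F (sample_path \<omega>) * G (N (Suc k) \<omega>))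
    = expectation (\<lambda>\<omega>. F (sample_path \<omega>) * (\<Sum>j<m. Q $$ (N k \<omega>, j) * G j))"
proof -
  let ?E = "\<lambda>j. {\<omega> \<in> space M. N (Suc k) \<omega> = j}"
  have *: "F (sample_path \<omega>) * G (N (Suc k) \<omega>)
      = (\<Sum>h\<in>histories k. \<Sum>j<m. F h * G j * indicator (cylinder k h \<inter> ?E j) \<omega>)"
    if \<omega>: "\<omega> \<in> space M" for \<omega>
  proof -
    have "G (N (Suc k) \<omega>) = (\<Sum>j<m. G j * indicator (?E j) \<omega>)"
      using N_less[OF \<omega>] \<omega> by (simp add: indicator_def if_distrib cong: if_cong)
    then show ?thesis
      by (simp only: history_expansion[OF F \<omega>] sum_product indicator_inter_arith mult_ac)
  qed
  have "expectation (\<lambda>\<omega>. F (sample_path \<omega>) * G (N (Suc k) \<omega>))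
      = expectation (\<lambda>\<omega>. \<Sum>h\<in>histories k. \<Sum>j<m. F h * G j * indicator (cylinder k h \<inter> ?E j) \<omega>)"
    by (intro Bochner_Integration.integral_cong) (simp_all only: *)
  also have "\<dots> = (\<Sum>h\<in>histories k. \<Sum>j<m. F h * G j * prob (cylinder k h \<inter> ?E j))"
  proof -
    have i: "integrable M (\<lambda>\<omega>. F h * G j * indicator (cylinder k h \<inter> ?E j) \<omega>)" for h j
      by (intro integrable_mult_right) (simp add: emeasure_eq_measure)
    have "expectation (\<lambda>\<omega>. F h * G j * indicator (cylinder k h \<inter> ?E j) \<omega>)
        = F h * G j * prob (cylinder k h \<inter> ?E j)" for h j
    proof -
      have "(cylinder k h \<inter> ?E j) \<inter> space M = cylinder k h \<inter> ?E j" by auto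
      then show ?thesis
        by (simp only: integral_mult_right_zero Bochner_Integration.integral_indicator)
    qed
    then show ?thesis
      using i by (simp only: Bochner_Integration.integral_sum Bochner_Integration.integrable_sum)
  qed
  also have "\<dots> = (\<Sum>h\<in>histories k. (F h * (\<Sum>j<m. Q $$ (h k, j) * G j)) * prob (cylinder k h))"
    by (simp add: prob_cylinder_step sum_distrib_left sum_distrib_right mult_ac)
  also have "\<dots> = expectation (\<lambda>\<omega>. F (sample_path \<omega>) * (\<Sum>j<m. Q $$ (N k \<omega>, j) * G j))"
  proof -
    have "adapted k (\<lambda>h. F h * (\<Sum>j<m. Q $$ (h k, j) * G j))"
      by (intro adapted_mult F adapted_at[of k]) simp
    from integral_history(2)[OF this] show ?thesis by simp
  qed
  finally show ?thesis .
qed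

text \<open>The index is shifted by one: \<open>first_passage j s\<close> is the probability that a chain started in
  \<open>s\<close> is at 0 for the first time after the start at time \<open>j + 1\<close>. The recursion conditions on
  the first step.\<close>

primrec first_passage :: "nat \<Rightarrow> nat \<Rightarrow> real" where
  "first_passage 0 s = Q $$ (s, 0)"
| "first_passage (Suc j) s = (\<Sum>a\<in>{1..<m}. Q $$ (s, a) * first_passage j a)"

lemma lessThan_split_0: "(\<Sum>a<m. g a) = g 0 + (\<Sum>a\<in>{1..<m}. g a)" for g :: "nat \<Rightarrow> real"
  using m_pos by (simp add: lessThan_atLeast0 sum.atLeast_Suc_lessThan)

text \<open>The Markov property for a waiting time. In the induction the requirement that the next state
  be nonzero is absorbed into \<open>F\<close>, and the induction hypothesis is applied one step later.\<close>

lemma markov_first_zero: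
  fixes F :: "(nat \<Rightarrow> nat) \<Rightarrow> real"
  assumes F: "adapted k F"
  shows "expectation (\<lambda>\<omega>. F (sample_path \<omega>) * of_bool (first_zero_after k (Suc (k + j)) (sample_path \<omega>)))
    = expectation (\<lambda>\<omega>. F (sample_path \<omega>) * first_passage j (N k \<omega>))"
  using F
proof (induction j arbitrary: k F)
  case 0
  have "{k<..<Suc k} = {}" by auto
  then show ?case
    using markov_step[OF 0, of "\<lambda>s. of_bool (s = 0)"] m_pos
    by (simp add: first_zero_after_def lessThan_split_0)
next
  case (Suc j)
  let ?F = "\<lambda>h. F h * of_bool (h (Suc k) \<noteq> 0)"
  have ad: "adapted (Suc k) ?F"
    by (rule adapted_mult[OF adapted_mono[OF Suc.prems] adapted_at]) simp_all
  have "first_zero_after k (Suc (k + Suc j)) h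
      \<longleftrightarrow> h (Suc k) \<noteq> 0 \<and> first_zero_after (Suc k) (Suc (Suc k + j)) h" for h
  proof -
    have "{k<..<Suc (k + Suc j)} = insert (Suc k) {Suc k<..<Suc (Suc k + j)}" by auto
    then show ?thesis by (auto simp: first_zero_after_def)
  qed
  then have "expectation (\<lambda>\<omega>. F (sample_path \<omega>) * of_bool (first_zero_after k (Suc (k + Suc j)) (sample_path \<omega>)))
    = expectation (\<lambda>\<omega>. ?F (sample_path \<omega>) * of_bool (first_zero_after (Suc k) (Suc (Suc k + j)) (sample_path \<omega>)))"
    by (intro Bochner_Integration.integral_cong) auto
  also have "\<dots> = expectation (\<lambda>\<omega>. ?F (sample_path \<omega>) * first_passage j (N (Suc k) \<omega>))"
    by (rule Suc.IH[OF ad])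
  also have "\<dots> = expectation (\<lambda>\<omega>. F (sample_path \<omega>) *
      (of_bool (N (Suc k) \<omega> \<noteq> 0) * first_passage j (N (Suc k) \<omega>)))"
    by (simp add: mult_ac)
  also have "\<dots> = expectation (\<lambda>\<omega>. F (sample_path \<omega>) * first_passage (Suc j) (N k \<omega>))"
    by (subst markov_step[OF Suc.prems]) (simp add: lessThan_split_0)
  finally show ?case .
qed

end

section \<open>Recurrence of state 0\<close>

context chain_from_0
begin

text \<open>\<open>survival n s\<close> is the probability that a chain started in \<open>s\<close> avoids 0 at all the times
  \<open>1, \<dots>, n\<close>.\<close>

primrec survival :: "nat \<Rightarrow> nat \<Rightarrow> real" where
  "survival 0 s = 1"
| "survival (Suc n) s = (\<Sum>a\<in>{1..<m}. Q $$ (s, a) * survival n a)"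

lemma first_passage_nonneg: "s < m \<Longrightarrow> 0 \<le> first_passage j s"
  by (induction j arbitrary: s) (auto intro!: sum_nonneg mult_nonneg_nonneg Q_nonneg simp: m_pos)

lemma survival_nonneg: "s < m \<Longrightarrow> 0 \<le> survival n s"
  by (induction n arbitrary: s) (auto intro!: sum_nonneg mult_nonneg_nonneg Q_nonneg)

lemma survival_step: "s < m \<Longrightarrow> survival n s = first_passage n s + survival (Suc n) s"
proof (induction n arbitrary: s)
  case 0
  then show ?case using Q_row[OF 0] by (simp add: lessThan_split_0)
next
  case (Suc n)
  have "survival (Suc n) s = (\<Sum>a\<in>{1..<m}. Q $$ (s, a) * (first_passage n a + survival (Suc n) a))"
    unfolding survival.simps(2)[of n s] by (intro sum.cong refl arg_cong2[where f = "(*)"] Suc.IH) simp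
  also have "\<dots> = first_passage (Suc n) s + survival (Suc (Suc n)) s"
    by (simp only: first_passage.simps(2) survival.simps(2)[of "Suc n"] sum.distrib distrib_left)
  finally show ?case .
qed

lemma sum_first_passage: "s < m \<Longrightarrow> (\<Sum>j<n. first_passage j s) = 1 - survival n s"
proof (induction n)
  case 0
  then show ?case by simp
next
  case (Suc n)
  then show ?case
    unfolding sum.lessThan_Suc using survival_step[OF Suc.prems, of n] by linarith
qed

lemma summable_first_passage: "s < m \<Longrightarrow> summable (\<lambda>j. first_passage j s)"
  by (rule summableI_nonneg_bounded[where x = 1])
     (auto simp: first_passage_nonneg sum_first_passage survival_nonneg)

lemma pow_Q_Suc:
  assumes "a < m" "b < m"
  shows "(Q ^\<^sub>m Suc n) $$ (a, b) = (\<Sum>c<m. (Q ^\<^sub>m n) $$ (a, c) * Q $$ (c, b))"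
  using assms Q_carrier pow_carrier_mat[OF Q_carrier, of n]
  by (simp add: scalar_prod_def lessThan_atLeast0)

lemma pow_Q_nonneg: "a < m \<Longrightarrow> b < m \<Longrightarrow> 0 \<le> (Q ^\<^sub>m n) $$ (a, b)"
proof (induction n arbitrary: b)
  case 0
  then show ?case using Q_carrier by auto
next
  case (Suc n)
  have "(Q ^\<^sub>m Suc n) $$ (a, b) = (\<Sum>c<m. (Q ^\<^sub>m n) $$ (a, c) * Q $$ (c, b))"
    by (rule pow_Q_Suc[OF Suc.prems])
  also have "\<dots> \<ge> 0"
    using Suc by (intro sum_nonneg mult_nonneg_nonneg Q_nonneg) auto
  finally show ?case .
qed

text \<open>The probability \<open>p a\<close> of never reaching 0 from \<open>a\<close> is harmonic off 0: it is the mean of \<open>p\<close>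
  over the next nonzero state. If its maximum were positive, then a state attaining it could only
  move to nonzero states that attain it as well, so that 0 would be unreachable from there, against
  irreducibility.\<close>

lemma first_passage_sums_1:
  assumes irred: "irreducible_matrix m Q" and s: "s < m"
  shows "(\<lambda>j. first_passage j s) sums 1"
proof -
  define p where "p a = 1 - (\<Sum>j. first_passage j a)" for a
  have lim: "(\<lambda>n. survival n a) \<longlonglongrightarrow> p a" if "a < m" for a
  proof -
    have "(\<lambda>n. 1 - (\<Sum>j<n. first_passage j a)) \<longlonglongrightarrow> p a"
      unfolding p_def
      by (intro tendsto_intros summable_LIMSEQ summable_first_passage that)
    then show ?thesis by (simp add: sum_first_passage[OF that])
  qed
  have p_nonneg: "0 \<le> p a" if "a < m" for a
    using lim[OF that] survival_nonneg[OF that] by (intro LIMSEQ_le_const) auto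
  have harmonic: "p a = (\<Sum>b\<in>{1..<m}. Q $$ (a, b) * p b)" if "a < m" for a
  proof (rule LIMSEQ_unique)
    show "(\<lambda>n. survival (Suc n) a) \<longlonglongrightarrow> p a"
      using lim[OF that] by (rule LIMSEQ_Suc)
    show "(\<lambda>n. survival (Suc n) a) \<longlonglongrightarrow> (\<Sum>b\<in>{1..<m}. Q $$ (a, b) * p b)"
      by (simp, intro tendsto_intros lim) auto
  qed
  define top where "top = Max (p ` {..<m})"
  have p_le: "p a \<le> top" if "a < m" for a
    using that by (auto simp: top_def)
  obtain a0 where a0: "a0 < m" "p a0 = top"
  proof -
    have "top \<in> p ` {..<m}"
      unfolding top_def using m_pos by (intro Max_in) auto
    with that show ?thesis by auto
  qed
  have "top \<le> 0"
  proof (rule ccontr)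
    assume "\<not> top \<le> 0"
    then have top: "0 < top" by simp
    \<comment> \<open>A mean of values at most \<open>top\<close> equals \<open>top\<close>, so all the deficits vanish; a transition to 0
      would have the deficit \<open>top > 0\<close>.\<close>
    have closed: "b \<noteq> 0 \<and> p b = top" if a: "a < m" "p a = top" and b: "b < m" "0 < Q $$ (a, b)" for a b
    proof -
      let ?t = "\<lambda>b. Q $$ (a, b) * (top - of_bool (b \<noteq> 0) * p b)"
      have "(\<Sum>b<m. ?t b) = top * (\<Sum>b<m. Q $$ (a, b)) - (\<Sum>b<m. Q $$ (a, b) * (of_bool (b \<noteq> 0) * p b))"
        by (simp add: right_diff_distrib sum_subtractf sum_distrib_left mult_ac)
      also have "(\<Sum>b<m. Q $$ (a, b) * (of_bool (b \<noteq> 0) * p b)) = p a"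
        by (subst harmonic[OF a(1)]) (simp add: lessThan_split_0)
      finally have "(\<Sum>b<m. ?t b) = 0"
        using a Q_row by simp
      moreover have "0 \<le> ?t b" if "b < m" for b
        using that top p_le[OF that] Q_nonneg[OF a(1) that]
        by (intro mult_nonneg_nonneg) auto
      ultimately have "?t b = 0"
        using b(1) sum_nonneg_eq_0_iff[of "{..<m}" ?t] by auto
      with b(2) top show ?thesis by (cases "b = 0") auto
    qed
    have reach: "p b = top \<and> (0 < n \<longrightarrow> b \<noteq> 0)" if "b < m" "0 < (Q ^\<^sub>m n) $$ (a0, b)" for n b
      using that
    proof (induction n arbitrary: b)
      case 0
      then have "b = a0" using a0 Q_carrier by (auto split: if_splits)
      then show ?case using a0 by simp
    next
      case (Suc n)
      have "(\<Sum>c<m. (Q ^\<^sub>m n) $$ (a0, c) * Q $$ (c, b)) \<noteq> 0"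
        using Suc.prems(2) unfolding pow_Q_Suc[OF a0(1) Suc.prems(1)] by linarith
      then obtain c where c: "c < m" "(Q ^\<^sub>m n) $$ (a0, c) * Q $$ (c, b) \<noteq> 0"
        by (rule sum.not_neutral_contains_not_neutral) simp
      then have "0 < (Q ^\<^sub>m n) $$ (a0, c)" "0 < Q $$ (c, b)"
        using pow_Q_nonneg[OF a0(1) c(1), of n] Q_nonneg[OF c(1) Suc.prems(1)]
        unfolding less_le by fastforce+
      then show ?case
        using Suc.IH[OF c(1)] closed[OF c(1) _ Suc.prems(1)] by simp
    qed
    obtain n where "n \<ge> 1" "0 < (Q ^\<^sub>m n) $$ (a0, 0)"
      using irred a0(1) m_pos by (auto simp: irreducible_matrix_def)
    with reach[OF m_pos this(2)] show False by simp
  qed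
  with p_le[OF s] p_nonneg[OF s] have "p s = 0" by simp
  then show ?thesis
    using summable_first_passage[OF s] by (simp add: p_def sums_iff)
qed

abbreviation return_prob :: "nat \<Rightarrow> real" where
  "return_prob j \<equiv> first_passage j 0"

text \<open>The chain starts afresh at 0: if \<open>F\<close> vanishes unless the chain is at 0 at time \<open>k\<close>, then the
  waiting time for the next zero is independent of \<open>F\<close>.\<close>

lemma renewal:
  fixes F :: "(nat \<Rightarrow> nat) \<Rightarrow> real"
  assumes F: "adapted k F" and zero: "\<And>h. h 0 = 0 \<Longrightarrow> F h \<noteq> 0 \<Longrightarrow> h k = 0"
  shows "expectation (\<lambda>\<omega>. F (sample_path \<omega>) * of_bool (first_zero_after k (Suc (k + j)) (sample_path \<omega>)))
    = expectation (\<lambda>\<omega>. F (sample_path \<omega>)) * return_prob j"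
proof -
  have "F (sample_path \<omega>) * first_passage j (N k \<omega>) = F (sample_path \<omega>) * return_prob j"
    if "\<omega> \<in> space M" for \<omega>
    using zero[of "sample_path \<omega>"] start[OF that] by (cases "F (sample_path \<omega>) = 0") auto
  then have "expectation (\<lambda>\<omega>. F (sample_path \<omega>) * first_passage j (N k \<omega>))
      = expectation (\<lambda>\<omega>. F (sample_path \<omega>) * return_prob j)"
    by (intro Bochner_Integration.integral_cong) auto
  then show ?thesis
    by (simp add: markov_first_zero[OF F])
qed

lemma prob_adapted:
  assumes P: "adapted k P"
  shows "{\<omega> \<in> space M. P (sample_path \<omega>)} \<in> sets M"
    and "prob {\<omega> \<in> space M. P (sample_path \<omega>)} = expectation (\<lambda>\<omega>. of_bool (P (sample_path \<omega>)))"
proof -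
  have "adapted k (\<lambda>h. of_bool (P h) :: real)"
    by (rule adapted_of_bool[OF P])
  from integral_history(1)[OF this]
  have "(\<lambda>\<omega>. of_bool (P (sample_path \<omega>)) :: real) \<in> borel_measurable M"
    by (rule borel_measurable_integrable)
  from measurable_sets[OF this, of "{1}"]
  have "(\<lambda>\<omega>. of_bool (P (sample_path \<omega>)) :: real) -` {1} \<inter> space M \<in> sets M"
    by simp
  also have "(\<lambda>\<omega>. of_bool (P (sample_path \<omega>)) :: real) -` {1} \<inter> space M
      = {\<omega> \<in> space M. P (sample_path \<omega>)}"
    by auto
  finally show sets: "{\<omega> \<in> space M. P (sample_path \<omega>)} \<in> sets M" .
  have "expectation (\<lambda>\<omega>. of_bool (P (sample_path \<omega>)))
      = expectation (indicator {\<omega> \<in> space M. P (sample_path \<omega>)})"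
    by (intro Bochner_Integration.integral_cong) (auto simp: indicator_def)
  also have "\<dots> = prob {\<omega> \<in> space M. P (sample_path \<omega>)}"
    using sets by (simp add: Int_absorb2)
  finally show "prob {\<omega> \<in> space M. P (sample_path \<omega>)}
      = expectation (\<lambda>\<omega>. of_bool (P (sample_path \<omega>)))" ..
qed

end

section \<open>Return times\<close>

text \<open>The decomposition by the last zero before time \<open>k + 1\<close>. On a path
  that is at 0 at the times 0 and \<open>k + 1\<close>, exactly one of the events
  \<open>first_zero_after l (Suc k)\<close> with \<open>h l = 0\<close> occurs, so the sum picks out a single term.\<close>

lemma last_zero_sum:
  fixes X :: "nat \<Rightarrow> real"
  assumes h: "h 0 = 0" "h (Suc k) = 0" and X: "\<forall>l. h l \<noteq> 0 \<longrightarrow> X l = 0"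
  shows "\<exists>L\<le>k. h L = 0 \<and> first_zero_after L (Suc k) h \<and>
    (\<Sum>l\<le>k. X l * of_bool (first_zero_after l (Suc k) h)) = X L \<and>
    (\<forall>l. h l = 0 \<longrightarrow> first_zero_after l (Suc k) h \<longrightarrow> l = L)"
proof -
  define L where "L = Max {l. l \<le> k \<and> h l = 0}"
  have L: "L \<le> k" "h L = 0"
  proof -
    have "L \<in> {l. l \<le> k \<and> h l = 0}"
      unfolding L_def using h(1) by (intro Max_in) auto
    then show "L \<le> k" "h L = 0" by auto
  qed
  have max: "l \<le> L" if "l \<le> k" "h l = 0" for l
    using that by (auto simp: L_def)
  have fz: "first_zero_after L (Suc k) h"
    unfolding first_zero_after_def
  proof (intro conjI ballI notI)
    fix r assume "r \<in> {L<..<Suc k}" "h r = 0"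
    with max[of r] show False by simp
  qed (use L h(2) in auto)
  have uniq: "l = L" if "h l = 0" "first_zero_after l (Suc k) h" for l
  proof -
    have "l \<le> k" using that by (simp add: first_zero_after_def)
    moreover have "\<not> l < L"
    proof
      assume "l < L"
      with L(1) have "L \<in> {l<..<Suc k}" by simp
      with that(2) L(2) show False unfolding first_zero_after_def by blast
    qed
    ultimately show ?thesis using max[of l] that by simp
  qed
  have "(\<Sum>l\<le>k. X l * of_bool (first_zero_after l (Suc k) h)) = (\<Sum>l\<le>k. if l = L then X l else 0)"
  proof (intro sum.cong refl)
    fix l
    show "X l * of_bool (first_zero_after l (Suc k) h) = (if l = L then X l else 0)"
    proof (cases "l = L")
      case True
      then show ?thesis using fz by simp
    next
      case False
      then have "h l \<noteq> 0 \<or> \<not> first_zero_after l (Suc k) h"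
        using uniq[of l] by blast
      then show ?thesis using False X by auto
    qed
  qed
  also have "\<dots> = X L" using L by simp
  finally have sum: "(\<Sum>l\<le>k. X l * of_bool (first_zero_after l (Suc k) h)) = X L" .
  show ?thesis
    by (intro exI[of _ L] conjI allI impI L fz sum uniq)
qed

text \<open>The event that the \<open>i\<close>-th return time equals \<open>l\<close>, as a property of the path up to time \<open>l\<close>.
  In this form the Markov property applies to it.\<close>

primrec return_at :: "nat \<Rightarrow> nat \<Rightarrow> (nat \<Rightarrow> nat) \<Rightarrow> bool" where
  "return_at 0 l h = (l = 0)"
| "return_at (Suc i) l h = (\<exists>l'<l. return_at i l' h \<and> first_zero_after l' l h)"

lemma adapted_return_at: "adapted l (return_at i l)"
proof (induction i arbitrary: l)
  case 0
  then show ?case by (simp add: adapted_def)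
next
  case (Suc i)
  show ?case unfolding adapted_def
  proof (intro allI impI)
    fix h h' :: "nat \<Rightarrow> nat"
    assume eq: "\<forall>r\<le>l. h r = h' r"
    have "return_at i l' h = return_at i l' h'" if "l' < l" for l'
      using that eq by (intro adaptedD[OF Suc]) auto
    moreover have "first_zero_after l' l h = first_zero_after l' l h'" for l'
      using eq by (intro adaptedD[OF adapted_first_zero_after]) auto
    ultimately show "return_at (Suc i) l h = return_at (Suc i) l h'" by auto
  qed
qed

lemma return_at_zero: "h 0 = 0 \<Longrightarrow> return_at i l h \<Longrightarrow> h l = 0"
  by (cases i) (auto simp: first_zero_after_def)

lemma Inf_enat_image_eq: "Inf (enat ` S) = enat n \<longleftrightarrow> n \<in> S \<and> (\<forall>r\<in>S. n \<le> r)"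
proof
  assume eq: "Inf (enat ` S) = enat n"
  have "S \<noteq> {}"
    using eq by (auto simp: Inf_enat_def)
  then have "Inf (enat ` S) \<in> enat ` S"
    unfolding Inf_enat_def by (auto intro: LeastI)
  then have "n \<in> S" by (auto simp: eq)
  moreover have "n \<le> r" if "r \<in> S" for r
    using Inf_lower[of "enat r" "enat ` S"] that eq by simp
  ultimately show "n \<in> S \<and> (\<forall>r\<in>S. n \<le> r)" by blast
next
  assume "n \<in> S \<and> (\<forall>r\<in>S. n \<le> r)"
  then show "Inf (enat ` S) = enat n"
    by (intro antisym Inf_lower Inf_greatest) auto
qed

lemma ret_time_Suc_eq_enat:
  assumes "ret_time N i \<omega> = enat l"
  shows "ret_time N (Suc i) \<omega> = enat k \<longleftrightarrow> first_zero_after l k (\<lambda>r. N r \<omega>)"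
proof -
  have "{enat k | k. ret_time N i \<omega> < enat k \<and> N k \<omega> = 0} = enat ` {k. l < k \<and> N k \<omega> = 0}"
    using assms by auto
  then have "ret_time N (Suc i) \<omega> = enat k \<longleftrightarrow>
      k \<in> {k. l < k \<and> N k \<omega> = 0} \<and> (\<forall>r\<in>{k. l < k \<and> N k \<omega> = 0}. k \<le> r)"
    using Inf_enat_image_eq by simp
  also have "\<dots> \<longleftrightarrow> first_zero_after l k (\<lambda>r. N r \<omega>)"
  proof -
    have "(\<forall>r\<in>{r. l < r \<and> N r \<omega> = 0}. k \<le> r) \<longleftrightarrow> (\<forall>r\<in>{l<..<k}. N r \<omega> \<noteq> 0)"
      (is "?A \<longleftrightarrow> ?B")
    proof
      assume ?A
      show ?B
      proof (intro ballI notI)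
        fix r assume "r \<in> {l<..<k}" "N r \<omega> = 0"
        with \<open>?A\<close> show False by fastforce
      qed
    next
      assume ?B
      show ?A
      proof (rule ballI, rule ccontr)
        fix r assume "r \<in> {r. l < r \<and> N r \<omega> = 0}" "\<not> k \<le> r"
        then have "r \<in> {l<..<k}" "N r \<omega> = 0" by auto
        with \<open>?B\<close> show False by blast
      qed
    qed
    then show ?thesis
      unfolding first_zero_after_def mem_Collect_eq by blast
  qed
  finally show ?thesis .
qed

lemma ret_time_Suc_infinity: "ret_time N i \<omega> = \<infinity> \<Longrightarrow> ret_time N (Suc i) \<omega> = \<infinity>"
  by (simp add: Inf_enat_def)

lemma ret_time_eq_enat: "ret_time N i \<omega> = enat l \<longleftrightarrow> return_at i l (\<lambda>k. N k \<omega>)"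
proof (induction i arbitrary: l)
  case 0
  then show ?case by (auto simp: zero_enat_def)
next
  case (Suc i)
  show ?case
  proof (cases "ret_time N i \<omega>")
    case (enat l')
    have "return_at i r (\<lambda>k. N k \<omega>) \<longleftrightarrow> r = l'" for r
      using Suc[of r] enat by auto
    then show ?thesis
      unfolding ret_time_Suc_eq_enat[OF enat] by (auto simp: first_zero_after_def)
  next
    case infinity
    then have "\<not> return_at i r (\<lambda>k. N k \<omega>)" for r
      using Suc[of r] by simp
    then show ?thesis
      using ret_time_Suc_infinity[OF infinity] by simp
  qed
qed

lemma inter_ret_time_eq_enat:
  "inter_ret_time N i \<omega> = enat (Suc j) \<longleftrightarrow>
    (\<exists>l. return_at i l (\<lambda>k. N k \<omega>) \<and> first_zero_after l (Suc (l + j)) (\<lambda>k. N k \<omega>))"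
proof (cases "ret_time N i \<omega>")
  case (enat l)
  have r: "return_at i r (\<lambda>k. N k \<omega>) \<longleftrightarrow> r = l" for r
    unfolding ret_time_eq_enat[symmetric] enat by auto
  have "inter_ret_time N i \<omega> = enat (Suc j) \<longleftrightarrow> ret_time N (Suc i) \<omega> = enat (Suc (l + j))"
    unfolding inter_ret_time_def enat by (cases "ret_time N (Suc i) \<omega>") auto
  then show ?thesis
    unfolding ret_time_Suc_eq_enat[OF enat] r by simp
next
  case infinity
  then have "\<not> return_at i r (\<lambda>k. N k \<omega>)" for r
    unfolding ret_time_eq_enat[symmetric] by simp
  moreover have "inter_ret_time N i \<omega> = \<infinity>"
    unfolding inter_ret_time_def ret_time_Suc_infinity[OF infinity] by simp
  ultimately show ?thesis by simp
qed

context chain_from_0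
begin

definition return_at_prob :: "nat \<Rightarrow> nat \<Rightarrow> real" where
  "return_at_prob i l = prob {\<omega> \<in> space M. return_at i l (sample_path \<omega>)}"

lemma return_at_prob_expectation:
  "return_at_prob i l = expectation (\<lambda>\<omega>. of_bool (return_at i l (sample_path \<omega>)))"
  unfolding return_at_prob_def by (rule prob_adapted(2)[OF adapted_return_at])

lemma return_at_renewal:
  "expectation (\<lambda>\<omega>. of_bool (return_at i l (sample_path \<omega>)) *
      of_bool (first_zero_after l (Suc (l + j)) (sample_path \<omega>)))
    = return_at_prob i l * return_prob j"
  unfolding return_at_prob_expectation
  by (intro renewal adapted_of_bool adapted_return_at) (simp add: return_at_zero)

lemma return_at_prob_Suc:
  "return_at_prob (Suc i) (Suc k) = (\<Sum>l\<le>k. return_at_prob i l * return_prob (k - l))"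
proof -
  let ?X = "\<lambda>l \<omega>. of_bool (return_at i l (sample_path \<omega>)) *
      of_bool (first_zero_after l (Suc k) (sample_path \<omega>)) :: real"
  have split: "of_bool (return_at (Suc i) (Suc k) (sample_path \<omega>)) = (\<Sum>l\<le>k. ?X l \<omega>)"
    if \<omega>: "\<omega> \<in> space M" for \<omega>
  proof (cases "N (Suc k) \<omega> = 0")
    case True
    have X0: "\<forall>l. N l \<omega> \<noteq> 0 \<longrightarrow> of_bool (return_at i l (sample_path \<omega>)) = (0 :: real)"
      using return_at_zero[of "sample_path \<omega>" i] start[OF \<omega>] by auto
    obtain L where L: "L \<le> k" "N L \<omega> = 0" "first_zero_after L (Suc k) (sample_path \<omega>)"
      "(\<Sum>l\<le>k. ?X l \<omega>) = of_bool (return_at i L (sample_path \<omega>))"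
      "\<forall>l. N l \<omega> = 0 \<longrightarrow> first_zero_after l (Suc k) (sample_path \<omega>) \<longrightarrow> l = L"
    proof -
      from last_zero_sum[where h = "sample_path \<omega>" and
          X = "\<lambda>l. of_bool (return_at i l (sample_path \<omega>))", OF start[OF \<omega>] True X0]
      show thesis by (elim exE conjE) (rule that)
    qed
    have "return_at (Suc i) (Suc k) (sample_path \<omega>) \<longleftrightarrow> return_at i L (sample_path \<omega>)"
    proof
      assume "return_at (Suc i) (Suc k) (sample_path \<omega>)"
      then obtain l where l: "return_at i l (sample_path \<omega>)" "first_zero_after l (Suc k) (sample_path \<omega>)"
        by auto
      have "N l \<omega> = 0"
        using return_at_zero[OF _ l(1)] start[OF \<omega>] by simp
      then have "l = L" using L(5) l(2) by blast
      with l(1) show "return_at i L (sample_path \<omega>)" by simp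
    next
      assume "return_at i L (sample_path \<omega>)"
      then show "return_at (Suc i) (Suc k) (sample_path \<omega>)"
        using L(1,3) le_imp_less_Suc return_at.simps(2) by blast
    qed
    then show ?thesis using L(4) by simp
  next
    case False
    then show ?thesis by (simp add: first_zero_after_def)
  qed
  have int: "integrable M (?X l)" if "l \<le> k" for l
  proof -
    have "adapted (Suc k) (\<lambda>h. of_bool (return_at i l h) * of_bool (first_zero_after l (Suc k) h) :: real)"
      using that
      by (intro adapted_mult adapted_of_bool adapted_first_zero_after
          adapted_mono[OF adapted_return_at[of l i]]) simp
    from integral_history(1)[OF this] show ?thesis .
  qed
  have "return_at_prob (Suc i) (Suc k) = expectation (\<lambda>\<omega>. \<Sum>l\<le>k. ?X l \<omega>)"
    unfolding return_at_prob_expectation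
    by (intro Bochner_Integration.integral_cong) (simp_all only: split)
  also have "\<dots> = (\<Sum>l\<le>k. expectation (?X l))"
    using int by (intro Bochner_Integration.integral_sum) auto
  also have "\<dots> = (\<Sum>l\<le>k. return_at_prob i l * return_prob (k - l))"
  proof (intro sum.cong refl)
    fix l assume "l \<in> {..k}"
    then show "expectation (?X l) = return_at_prob i l * return_prob (k - l)"
      using return_at_renewal[of i l "k - l"] by simp
  qed
  finally show ?thesis .
qed

text \<open>Almost surely the \<open>i\<close>-th return time is finite: its law is the convolution of the law of the
  previous one with the return law, and both have total mass 1.\<close>

lemma return_at_prob_sums:
  assumes irred: "irreducible_matrix m Q"
  shows "return_at_prob i sums 1"
proof (induction i)
  case 0
  have "return_at_prob 0 = (\<lambda>l. if l = 0 then 1 else 0)"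
    by (auto simp: return_at_prob_def prob_space)
  then show ?case using sums_single[of 0 "\<lambda>_. 1 :: real"] by simp
next
  case (Suc i)
  have "(\<lambda>k. \<Sum>l\<le>k. return_at_prob i l * return_prob (k - l))
      sums ((\<Sum>l. return_at_prob i l) * (\<Sum>j. return_prob j))"
    using Suc first_passage_sums_1[OF irred m_pos]
    by (intro Cauchy_product_sums)
       (auto simp: sums_iff first_passage_nonneg m_pos return_at_prob_def)
  then have "(\<lambda>k. return_at_prob (Suc i) (Suc k)) sums 1"
    using Suc first_passage_sums_1[OF irred m_pos] by (simp add: return_at_prob_Suc sums_iff)
  moreover have "return_at_prob (Suc i) 0 = 0"
    by (simp add: return_at_prob_def)
  ultimately show ?case by (simp add: sums_Suc_iff)
qed

text \<open>All inter-return times have the law of the first one: sum over the values of the \<open>i\<close>-th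
  return time, whose probabilities add up to 1.\<close>

lemma prob_inter_ret_time:
  assumes irred: "irreducible_matrix m Q"
  shows "\<P>(\<omega> in M. inter_ret_time N i \<omega> = enat (Suc j)) = return_prob j"
proof -
  define E where "E l = {\<omega> \<in> space M. return_at i l (sample_path \<omega>) \<and>
      first_zero_after l (Suc (l + j)) (sample_path \<omega>)}" for l
  have ad: "adapted (Suc (l + j)) (\<lambda>h. return_at i l h \<and> first_zero_after l (Suc (l + j)) h)" for l
    by (intro adapted_conj adapted_first_zero_after adapted_mono[OF adapted_return_at]) simp
  have sets: "E l \<in> sets M" for l
    unfolding E_def by (rule prob_adapted(1)[OF ad])
  have prob_E: "prob (E l) = return_at_prob i l * return_prob j" for l
    unfolding E_def prob_adapted(2)[OF ad] return_at_renewal[symmetric] of_bool_conj ..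
  have "return_at i l h \<Longrightarrow> return_at i l' h \<Longrightarrow> l = l'" for l l' h
    using ret_time_eq_enat[of "\<lambda>k _. h k" i undefined] by (metis enat.inject)
  then have "disjoint_family E"
    unfolding disjoint_family_on_def E_def by blast
  then have "(\<lambda>l. prob (E l)) sums prob (\<Union>l. E l)"
    using sets by (intro finite_measure_UNION) auto
  moreover have "(\<Union>l. E l) = {\<omega> \<in> space M. inter_ret_time N i \<omega> = enat (Suc j)}"
    by (auto simp: E_def inter_ret_time_eq_enat)
  ultimately have "(\<lambda>l. return_at_prob i l * return_prob j)
      sums \<P>(\<omega> in M. inter_ret_time N i \<omega> = enat (Suc j))"
    by (simp add: prob_E)
  moreover have "(\<lambda>l. return_at_prob i l * return_prob j) sums (1 * return_prob j)"
    by (intro sums_mult2 return_at_prob_sums irred)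
  ultimately show ?thesis
    using sums_unique2 by fastforce
qed

lemma contraction_factor_sums:
  assumes irred: "irreducible_matrix m Q" and \<rho>: "0 \<le> \<rho>" "\<rho> < 1"
  shows "(\<lambda>j. \<alpha> * (return_prob j * \<rho> ^ j)) sums contraction_factor M N \<alpha> \<rho> i"
proof -
  have nonneg: "0 \<le> return_prob j * \<rho> ^ j" for j
    using \<rho> first_passage_nonneg[OF m_pos] by simp
  have "return_prob j * \<rho> ^ j \<le> return_prob j" for j
    using \<rho> first_passage_nonneg[OF m_pos] by (simp add: mult_left_le power_le_one)
  then have sm: "summable (\<lambda>j. return_prob j * \<rho> ^ j)"
    using nonneg by (intro summable_comparison_test[OF _ summable_first_passage[OF m_pos]]) auto
  have "{1..} = range Suc"
    by (auto simp: image_iff) (metis Suc_le_D)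
  then have "(\<Sum>\<^sub>\<infinity>j\<in>{1..}. \<P>(\<omega> in M. inter_ret_time N i \<omega> = enat j) * \<rho> ^ (j - 1))
      = (\<Sum>\<^sub>\<infinity>j. return_prob j * \<rho> ^ j)"
    by (simp add: infsum_reindex o_def prob_inter_ret_time[OF irred])
  also have "\<dots> = (\<Sum>j. return_prob j * \<rho> ^ j)"
    using sums_nonneg_imp_has_sum[OF summable_sums[OF sm]] nonneg by (intro infsumI) auto
  finally show ?thesis
    unfolding contraction_factor_def using sums_mult[OF summable_sums[OF sm]] by simp
qed

end

section \<open>Independence of the initial state\<close>

lemma sigma_sets_compose_vimage:
  assumes Z: "Z \<in> \<Omega> \<rightarrow> space K" and H: "H \<in> measurable K K'"
  shows "sigma_sets \<Omega> {(\<lambda>\<omega>. H (Z \<omega>)) -` A \<inter> \<Omega> | A. A \<in> sets K'}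
    \<subseteq> sets (vimage_algebra \<Omega> Z K)"
proof -
  have m: "(\<lambda>\<omega>. H (Z \<omega>)) \<in> measurable (vimage_algebra \<Omega> Z K) K'"
    by (rule measurable_compose[OF measurable_vimage_algebra1[OF Z] H])
  have "{(\<lambda>\<omega>. H (Z \<omega>)) -` A \<inter> \<Omega> | A. A \<in> sets K'} \<subseteq> sets (vimage_algebra \<Omega> Z K)"
  proof
    fix B assume "B \<in> {(\<lambda>\<omega>. H (Z \<omega>)) -` A \<inter> \<Omega> | A. A \<in> sets K'}"
    then obtain A where "A \<in> sets K'" "B = (\<lambda>\<omega>. H (Z \<omega>)) -` A \<inter> \<Omega>"
      by blast
    with measurable_sets[OF m, of A] show "B \<in> sets (vimage_algebra \<Omega> Z K)"
      by simp
  qed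
  from sets.sigma_sets_subset[OF this] show ?thesis by simp
qed

text \<open>\<^const>\<open>prob_space.indep_var\<close> requires both variables to have values in the same type, which
  the initial state and the path of the chain do not. Independence is therefore stated for their
  generated \<open>\<sigma>\<close>-algebras, and passes to random variables only after composition.\<close>

lemma (in prob_space) indep_var_compose_vimage:
  assumes indep: "indep_set (sets (vimage_algebra (space M) X S)) (sets (vimage_algebra (space M) Y T))"
    and X: "X \<in> measurable M S" "F \<in> measurable S S'"
    and Y: "Y \<in> measurable M T" "G \<in> measurable T T'"
  shows "indep_var S' (\<lambda>\<omega>. F (X \<omega>)) T' (\<lambda>\<omega>. G (Y \<omega>))"
proof -
  have XS: "X \<in> space M \<rightarrow> space S" and YT: "Y \<in> space M \<rightarrow> space T"
    using measurable_space[OF X(1)] measurable_space[OF Y(1)] by blast+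
  have "indep_set (sigma_sets (space M) {(\<lambda>\<omega>. F (X \<omega>)) -` A \<inter> space M | A. A \<in> sets S'})
     (sigma_sets (space M) {(\<lambda>\<omega>. G (Y \<omega>)) -` A \<inter> space M | A. A \<in> sets T'})"
    unfolding indep_set_def
  proof (rule indep_sets_mono_sets[OF indep[unfolded indep_set_def]])
    fix b :: bool
    show "case_bool (sigma_sets (space M) {(\<lambda>\<omega>. F (X \<omega>)) -` A \<inter> space M | A. A \<in> sets S'})
        (sigma_sets (space M) {(\<lambda>\<omega>. G (Y \<omega>)) -` A \<inter> space M | A. A \<in> sets T'}) b
      \<subseteq> case_bool (sets (vimage_algebra (space M) X S)) (sets (vimage_algebra (space M) Y T)) b"
      using sigma_sets_compose_vimage[OF XS X(2)] sigma_sets_compose_vimage[OF YT Y(2)]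
      by (cases b) (simp_all only: bool.case)
  qed
  then show ?thesis
    unfolding indep_var_eq
    using measurable_compose[OF X] measurable_compose[OF Y] by blast
qed

section \<open>The mean gain\<close>

text \<open>The factor by which the Lyapunov function may have grown by time \<open>k\<close> on the path \<open>h\<close>.\<close>

definition gain :: "real \<Rightarrow> real \<Rightarrow> nat \<Rightarrow> (nat \<Rightarrow> nat) \<Rightarrow> real" where
  "gain \<alpha> \<rho> k h = (\<Prod>l<k. if h l = 0 then \<alpha> else \<rho>)"

lemma gain_0 [simp]: "gain \<alpha> \<rho> 0 h = 1"
  and gain_Suc: "gain \<alpha> \<rho> (Suc k) h = gain \<alpha> \<rho> k h * (if h k = 0 then \<alpha> else \<rho>)"
  by (simp_all add: gain_def)

lemma gain_nonneg: "0 \<le> \<alpha> \<Longrightarrow> 0 \<le> \<rho> \<Longrightarrow> 0 \<le> gain \<alpha> \<rho> k h"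
  by (auto simp: gain_def intro!: prod_nonneg)

lemma adapted_gain: "adapted k (gain \<alpha> \<rho> k)"
  by (auto simp: adapted_def gain_def intro!: prod.cong)

text \<open>A cycle consists of one step without control followed by \<open>j\<close> controlled ones.\<close>

lemma gain_cycle:
  assumes "h l = 0" "\<And>r. l < r \<Longrightarrow> r \<le> l + j \<Longrightarrow> h r \<noteq> 0"
  shows "gain \<alpha> \<rho> (Suc (l + j)) h = gain \<alpha> \<rho> l h * (\<alpha> * \<rho> ^ j)"
  using assms(2)
proof (induction j)
  case 0
  then show ?case using assms(1) by (simp add: gain_Suc)
next
  case (Suc j)
  have "gain \<alpha> \<rho> (Suc (l + j)) h = gain \<alpha> \<rho> l h * (\<alpha> * \<rho> ^ j)"
    using Suc.prems by (intro Suc.IH) auto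
  then show ?case
    using Suc.prems[of "Suc (l + j)"] by (simp add: gain_Suc[of _ _ "Suc (l + j)"])
qed

context chain_from_0
begin

lemma adapted_gain_at_0: "adapted k (\<lambda>h. gain \<alpha> \<rho> k h * of_bool (h k = 0))"
  by (intro adapted_mult adapted_gain adapted_at[of k]) simp

definition mean_gain :: "real \<Rightarrow> real \<Rightarrow> nat \<Rightarrow> real" where
  "mean_gain \<alpha> \<rho> k = expectation (\<lambda>\<omega>. gain \<alpha> \<rho> k (sample_path \<omega>))"

definition mean_gain_at_0 :: "real \<Rightarrow> real \<Rightarrow> nat \<Rightarrow> real" where
  "mean_gain_at_0 \<alpha> \<rho> k = expectation (\<lambda>\<omega>. gain \<alpha> \<rho> k (sample_path \<omega>) * of_bool (N k \<omega> = 0))"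

lemma mean_gain_0: "mean_gain \<alpha> \<rho> 0 = 1"
  by (simp add: mean_gain_def prob_space)

lemma mean_gain_at_0_0: "mean_gain_at_0 \<alpha> \<rho> 0 = 1"
proof -
  have "mean_gain_at_0 \<alpha> \<rho> 0 = expectation (\<lambda>\<omega>. 1)"
    unfolding mean_gain_at_0_def by (intro Bochner_Integration.integral_cong) (auto simp: start)
  then show ?thesis by (simp add: prob_space)
qed

text \<open>The one-step factor is \<open>\<rho>\<close>, corrected by \<open>\<alpha> - \<rho>\<close> when the chain is at 0.\<close>

lemma mean_gain_Suc:
  "mean_gain \<alpha> \<rho> (Suc k) = \<rho> * mean_gain \<alpha> \<rho> k + (\<alpha> - \<rho>) * mean_gain_at_0 \<alpha> \<rho> k"
proof -
  have "mean_gain \<alpha> \<rho> (Suc k) = expectation (\<lambda>\<omega>. \<rho> * gain \<alpha> \<rho> k (sample_path \<omega>) +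
      (\<alpha> - \<rho>) * (gain \<alpha> \<rho> k (sample_path \<omega>) * of_bool (N k \<omega> = 0)))"
    unfolding mean_gain_def
    by (intro Bochner_Integration.integral_cong) (auto simp: gain_Suc algebra_simps)
  also have "\<dots> = \<rho> * mean_gain \<alpha> \<rho> k + (\<alpha> - \<rho>) * mean_gain_at_0 \<alpha> \<rho> k"
    unfolding mean_gain_def mean_gain_at_0_def
    using integral_history(1)[OF adapted_gain] integral_history(1)[OF adapted_gain_at_0]
    by simp
  finally show ?thesis .
qed

text \<open>The renewal equation. Between the last zero \<open>l\<close> before time \<open>k + 1\<close> and time \<open>k + 1\<close> the gain
  grows by the deterministic factor \<open>\<alpha> * \<rho> ^ (k - l)\<close>, and the cycle is independent of the
  gain up to \<open>l\<close>.\<close>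

lemma mean_gain_at_0_Suc:
  "mean_gain_at_0 \<alpha> \<rho> (Suc k)
    = (\<Sum>l\<le>k. mean_gain_at_0 \<alpha> \<rho> l * (\<alpha> * (return_prob (k - l) * \<rho> ^ (k - l))))"
proof -
  let ?Y = "\<lambda>l \<omega>. gain \<alpha> \<rho> l (sample_path \<omega>) * of_bool (N l \<omega> = 0) *
      of_bool (first_zero_after l (Suc k) (sample_path \<omega>))"
  let ?X = "\<lambda>l \<omega>. ?Y l \<omega> * (\<alpha> * \<rho> ^ (k - l))"
  have split: "gain \<alpha> \<rho> (Suc k) (sample_path \<omega>) * of_bool (N (Suc k) \<omega> = 0) = (\<Sum>l\<le>k. ?X l \<omega>)"
    if \<omega>: "\<omega> \<in> space M" for \<omega>
  proof (cases "N (Suc k) \<omega> = 0")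
    case True
    have X0: "\<forall>l. N l \<omega> \<noteq> 0 \<longrightarrow>
        gain \<alpha> \<rho> l (sample_path \<omega>) * of_bool (N l \<omega> = 0) * (\<alpha> * \<rho> ^ (k - l)) = 0"
      by simp
    obtain L where L: "L \<le> k" "N L \<omega> = 0" "first_zero_after L (Suc k) (sample_path \<omega>)"
      and sum: "(\<Sum>l\<le>k. gain \<alpha> \<rho> l (sample_path \<omega>) * of_bool (N l \<omega> = 0) * (\<alpha> * \<rho> ^ (k - l)) *
        of_bool (first_zero_after l (Suc k) (sample_path \<omega>)))
        = gain \<alpha> \<rho> L (sample_path \<omega>) * of_bool (N L \<omega> = 0) * (\<alpha> * \<rho> ^ (k - L))"
    proof -
      from last_zero_sum[where h = "sample_path \<omega>" and
          X = "\<lambda>l. gain \<alpha> \<rho> l (sample_path \<omega>) * of_bool (N l \<omega> = 0) * (\<alpha> * \<rho> ^ (k - l))", OF start[OF \<omega>] True X0]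
      show thesis by (elim exE conjE) (rule that)
    qed
    have "gain \<alpha> \<rho> (Suc (L + (k - L))) (sample_path \<omega>)
        = gain \<alpha> \<rho> L (sample_path \<omega>) * (\<alpha> * \<rho> ^ (k - L))"
      using L by (intro gain_cycle) (auto simp: first_zero_after_def)
    then show ?thesis
      using sum L True by (simp add: mult_ac)
  next
    case False
    then show ?thesis by (simp add: first_zero_after_def)
  qed
  have int: "integrable M (?Y l)" if "l \<le> k" for l
  proof -
    have "adapted (Suc k) (\<lambda>h. gain \<alpha> \<rho> l h * of_bool (h l = 0) * of_bool (first_zero_after l (Suc k) h))"
      using that
      by (intro adapted_mult[of _ "\<lambda>h. gain \<alpha> \<rho> l h * of_bool (h l = 0)"] adapted_of_bool
          adapted_first_zero_after adapted_mono[OF adapted_gain_at_0[of l \<alpha> \<rho>]]) simp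
    from integral_history(1)[OF this] show ?thesis .
  qed
  have "mean_gain_at_0 \<alpha> \<rho> (Suc k) = expectation (\<lambda>\<omega>. \<Sum>l\<le>k. ?X l \<omega>)"
    unfolding mean_gain_at_0_def
    by (intro Bochner_Integration.integral_cong) (simp_all only: split)
  also have "\<dots> = (\<Sum>l\<le>k. expectation (?X l))"
    by (intro Bochner_Integration.integral_sum integrable_mult_left int) auto
  also have "\<dots> = (\<Sum>l\<le>k. mean_gain_at_0 \<alpha> \<rho> l * (\<alpha> * (return_prob (k - l) * \<rho> ^ (k - l))))"
  proof (intro sum.cong refl)
    fix l assume l: "l \<in> {..k}"
    have "expectation (?X l) = expectation (?Y l) * (\<alpha> * \<rho> ^ (k - l))"
      by (rule integral_mult_left_zero)
    also have "expectation (?Y l) = mean_gain_at_0 \<alpha> \<rho> l * return_prob (k - l)"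
      using renewal[OF adapted_gain_at_0[of l \<alpha> \<rho>], of "k - l"] l
      by (simp add: mean_gain_at_0_def)
    finally show "expectation (?X l)
        = mean_gain_at_0 \<alpha> \<rho> l * (\<alpha> * (return_prob (k - l) * \<rho> ^ (k - l)))"
      by (simp add: mult_ac)
  qed
  finally show ?thesis .
qed

text \<open>The total has to be known exactly: for \<open>\<alpha> < \<rho>\<close> an upper bound for the sum of
  \<open>mean_gain_at_0\<close> would not give one for the sum of \<open>mean_gain\<close>.\<close>

lemma mean_gain_sums:
  assumes irred: "irreducible_matrix m Q" and \<rho>: "0 \<le> \<rho>" "\<rho> < 1" and \<alpha>: "0 \<le> \<alpha>"
    and \<Theta>: "\<Theta> = contraction_factor M N \<alpha> \<rho> i" "\<Theta> < 1"
  shows "mean_gain \<alpha> \<rho> sums ((1 + \<alpha> - \<rho> - \<Theta>) / ((1 - \<Theta>) * (1 - \<rho>)))"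
    and "0 \<le> \<Theta>"
proof -
  have c: "(\<lambda>j. \<alpha> * (return_prob j * \<rho> ^ j)) sums \<Theta>"
    unfolding \<Theta> by (rule contraction_factor_sums[OF irred \<rho>])
  have c_nonneg: "0 \<le> \<alpha> * (return_prob j * \<rho> ^ j)" for j
    using \<alpha> \<rho> first_passage_nonneg[OF m_pos] by simp
  show "0 \<le> \<Theta>"
    using sums_le[OF _ sums_zero c] c_nonneg by simp
  have nonneg: "0 \<le> mean_gain_at_0 \<alpha> \<rho> k" for k
    unfolding mean_gain_at_0_def using gain_nonneg \<alpha> \<rho> by (intro Bochner_Integration.integral_nonneg) auto
  have "mean_gain_at_0 \<alpha> \<rho> sums (1 / (1 - \<Theta>))"
    by (rule renewal_sums[OF c_nonneg c \<Theta>(2) nonneg mean_gain_at_0_0 mean_gain_at_0_Suc])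
  from geometric_recursion_sums[OF \<rho> nonneg this mean_gain_Suc]
  have "mean_gain \<alpha> \<rho> sums ((1 + (\<alpha> - \<rho>) * (1 / (1 - \<Theta>))) / (1 - \<rho>))"
    by (simp add: mean_gain_0)
  also have "(1 + (\<alpha> - \<rho>) * (1 / (1 - \<Theta>))) / (1 - \<rho>)
      = (1 + \<alpha> - \<rho> - \<Theta>) / ((1 - \<Theta>) * (1 - \<rho>))"
    using \<Theta>(2) \<rho>(2) by (simp add: field_simps)
  finally show "mean_gain \<alpha> \<rho> sums ((1 + \<alpha> - \<rho> - \<Theta>) / ((1 - \<Theta>) * (1 - \<rho>)))" .
qed

lemma nn_integral_gain_indep:
  fixes g :: "'b::topological_space \<Rightarrow> real"
  assumes X [measurable]: "X \<in> borel_measurable M"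
    and indep: "indep_set (sets (vimage_algebra (space M) X borel))
       (sets (vimage_algebra (space M) (\<lambda>\<omega> k. N k \<omega>) (PiM UNIV (\<lambda>_. count_space {..<m}))))"
    and g: "g \<in> borel_measurable borel" "\<And>z. 0 \<le> g z" "integrable M (\<lambda>\<omega>. g (X \<omega>))"
    and nonneg: "0 \<le> \<alpha>" "0 \<le> \<rho>"
  shows "(\<integral>\<^sup>+ \<omega>. ennreal (gain \<alpha> \<rho> k (sample_path \<omega>) * g (X \<omega>)) \<partial>M)
    = ennreal (mean_gain \<alpha> \<rho> k * expectation (\<lambda>\<omega>. g (X \<omega>)))"
proof -
  let ?P = "PiM UNIV (\<lambda>_::nat. count_space {..<m})"
  have "(\<lambda>\<omega> k. N k \<omega>) \<in> measurable M ?P"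
    by (rule measurable_PiM_single') (auto simp: N_less)
  moreover have "gain \<alpha> \<rho> k \<in> borel_measurable ?P"
    unfolding gain_def by measurable
  ultimately have iv: "indep_var borel (\<lambda>\<omega>. g (X \<omega>)) borel (\<lambda>\<omega>. gain \<alpha> \<rho> k (sample_path \<omega>))"
    using g(1) X by (intro indep_var_compose_vimage[OF indep])
  have i: "integrable M (\<lambda>\<omega>. gain \<alpha> \<rho> k (sample_path \<omega>))"
    by (rule integral_history(1)[OF adapted_gain])
  have "(\<integral>\<^sup>+ \<omega>. ennreal (gain \<alpha> \<rho> k (sample_path \<omega>) * g (X \<omega>)) \<partial>M)
      = ennreal (expectation (\<lambda>\<omega>. g (X \<omega>) * gain \<alpha> \<rho> k (sample_path \<omega>)))"
    unfolding mult.commute[of "gain _ _ _ _"]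
    using indep_var_integrable[OF iv g(3) i] gain_nonneg[OF nonneg] g(2)
    by (intro nn_integral_eq_integral) auto
  then show ?thesis
    using indep_var_lebesgue_integral[OF iv g(3) i] by (simp add: mean_gain_def mult.commute)
qed

end

section \<open>Stability of the control loop\<close>

theorem theoremV5:
  fixes M :: "'w measure"
    and f :: "real ^ 'n \<Rightarrow> real ^ 'p \<Rightarrow> real ^ 'n"
    and \<kappa> :: "real ^ 'n \<Rightarrow> real ^ 'p"
    and V :: "real ^ 'n \<Rightarrow> real"
    and \<phi>\<^sub>1 \<phi>\<^sub>2 :: "real \<Rightarrow> real"
    and \<rho> \<alpha> \<Theta> :: real
    and \<Lambda> i :: nat
    and Q :: "real mat"
    and N :: "nat \<Rightarrow> 'w \<Rightarrow> nat"
    and x :: "nat \<Rightarrow> 'w \<Rightarrow> real ^ 'n"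
    and u :: "nat \<Rightarrow> 'w \<Rightarrow> real ^ 'p"
  assumes prob: "prob_space M"
    and Lambda: "2 \<le> \<Lambda>"
    and equilibrium: "f 0 0 = 0"
    and random: "\<And>k. x k \<in> borel_measurable M"
    and plant: "\<And>k \<omega>. \<omega> \<in> space M \<Longrightarrow> x (Suc k) \<omega> = f (x k \<omega>) (u k \<omega>)"
    and A1_phi: "\<phi>\<^sub>1 \<in> class_K_inf" "\<phi>\<^sub>2 \<in> class_K_inf"
    and A1_rho: "0 \<le> \<rho>" "\<rho> < 1"
    and A1_V: "\<And>z. 0 \<le> V z" "\<And>z. \<phi>\<^sub>1 (norm z) \<le> V z" "\<And>z. V z \<le> \<phi>\<^sub>2 (norm z)"
    and A1_kappa: "\<And>z. V (f z (\<kappa> z)) \<le> \<rho> * V z"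
    and A2_markov: "markov_chain M (\<Lambda> + 1) Q N"
    and A2_init: "\<And>\<omega>. \<omega> \<in> space M \<Longrightarrow> N 0 \<omega> = 0"
    and A2_irred: "irreducible_matrix (\<Lambda> + 1) Q"
    and A2_aper: "aperiodic_matrix (\<Lambda> + 1) Q"
    and indep: "prob_space.indep_set M (sets (vimage_algebra (space M) (x 0) borel))
       (sets (vimage_algebra (space M) (\<lambda>\<omega> k. N k \<omega>) (PiM UNIV (\<lambda>_. count_space {..<\<Lambda> + 1}))))"
    and A3_alpha: "0 \<le> \<alpha>" "\<And>z. V (f z 0) \<le> \<alpha> * V z"
    and A3_moment: "(\<integral>\<^sup>+ \<omega>. ennreal (\<phi>\<^sub>2 (norm (x 0 \<omega>))) \<partial>M) < \<infinity>"
    and baseline: "\<And>k \<omega>. \<omega> \<in> space M \<Longrightarrow>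
       u k \<omega> = (if N k \<omega> \<in> {1..\<Lambda>} then \<kappa> (x k \<omega>) else 0)"
    and Theta: "\<Theta> = contraction_factor M N \<alpha> \<rho> i" "\<Theta> < 1"
  shows "stochastically_stable M x \<and>
    total_cost M \<phi>\<^sub>1 x
      \<le> ennreal ((1 + \<alpha> - \<rho>) / ((1 - \<Theta>) * (1 - \<rho>))) * (\<integral>\<^sup>+ \<omega>. ennreal (\<phi>\<^sub>2 (norm (x 0 \<omega>))) \<partial>M) \<and>
    (0 < \<Theta> \<and> \<not> (AE \<omega> in M. x 0 \<omega> = 0) \<longrightarrow>
     total_cost M \<phi>\<^sub>1 x
      < ennreal ((1 + \<alpha> - \<rho>) / ((1 - \<Theta>) * (1 - \<rho>))) * (\<integral>\<^sup>+ \<omega>. ennreal (\<phi>\<^sub>2 (norm (x 0 \<omega>))) \<partial>M))"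
proof -
  interpret chain_from_0 M "\<Lambda> + 1" Q N
    using prob A2_markov A2_init by (simp add: chain_from_0_def chain_from_0_axioms_def)
  define B where "B = (1 + \<alpha> - \<rho>) / ((1 - \<Theta>) * (1 - \<rho>))"
  define S where "S = (1 + \<alpha> - \<rho> - \<Theta>) / ((1 - \<Theta>) * (1 - \<rho>))"
  define g where "g z = \<phi>\<^sub>2 (norm z)" for z :: "real ^ 'n"
  define e where "e = expectation (\<lambda>\<omega>. g (x 0 \<omega>))"
  note [measurable] = random
  have g_nonneg: "0 \<le> g z" for z
    using A1_phi(2) by (auto simp: class_K_inf_def g_def)
  have "continuous_on UNIV g"
    unfolding g_def using A1_phi(2)
    by (intro continuous_on_compose2[of "{0..}" \<phi>\<^sub>2 UNIV norm]) (auto simp: class_K_inf_def intro: continuous_intros)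
  then have g_meas [measurable]: "g \<in> borel_measurable borel"
    by (rule borel_measurable_continuous_onI)
  have g_int: "integrable M (\<lambda>\<omega>. g (x 0 \<omega>))"
    using A3_moment g_nonneg by (intro integrableI_nonneg) (auto simp: g_def[symmetric])
  have moment: "(\<integral>\<^sup>+ \<omega>. ennreal (\<phi>\<^sub>2 (norm (x 0 \<omega>))) \<partial>M) = ennreal e"
    unfolding e_def g_def[symmetric] using g_int g_nonneg by (intro nn_integral_eq_integral) auto
  have e_nonneg: "0 \<le> e"
    unfolding e_def using g_nonneg by (intro Bochner_Integration.integral_nonneg) auto

  \<comment> \<open>\<open>V\<close> need not be measurable, so expectations are taken only after \<open>V\<close> has been eliminated
    between \<open>\<phi>\<^sub>1\<close> and \<open>\<phi>\<^sub>2\<close>.\<close>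
  have decay: "V (x k \<omega>) \<le> gain \<alpha> \<rho> k (sample_path \<omega>) * V (x 0 \<omega>)" if \<omega>: "\<omega> \<in> space M" for k \<omega>
  proof (induction k)
    case 0
    then show ?case by simp
  next
    case (Suc k)
    let ?c = "if N k \<omega> = 0 then \<alpha> else \<rho>"
    have "V (x (Suc k) \<omega>) \<le> ?c * V (x k \<omega>)"
      using plant[OF \<omega>] baseline[OF \<omega>] N_less[OF \<omega>, of k] A1_kappa A3_alpha(2)
      by (auto simp: less_Suc_eq_le)
    also have "\<dots> \<le> ?c * (gain \<alpha> \<rho> k (sample_path \<omega>) * V (x 0 \<omega>))"
      using Suc A3_alpha(1) A1_rho(1) by (intro mult_left_mono) auto
    finally show ?case by (simp add: gain_Suc mult_ac)
  qed

  have term_le: "(\<integral>\<^sup>+ \<omega>. ennreal (\<phi>\<^sub>1 (norm (x k \<omega>))) \<partial>M) \<le> ennreal (mean_gain \<alpha> \<rho> k * e)" for k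
  proof -
    have "(\<integral>\<^sup>+ \<omega>. ennreal (\<phi>\<^sub>1 (norm (x k \<omega>))) \<partial>M)
        \<le> (\<integral>\<^sup>+ \<omega>. ennreal (gain \<alpha> \<rho> k (sample_path \<omega>) * g (x 0 \<omega>)) \<partial>M)"
    proof (intro nn_integral_mono ennreal_leI)
      fix \<omega> assume \<omega>: "\<omega> \<in> space M"
      have "\<phi>\<^sub>1 (norm (x k \<omega>)) \<le> gain \<alpha> \<rho> k (sample_path \<omega>) * V (x 0 \<omega>)"
        using A1_V(2) decay[OF \<omega>] by (rule order_trans)
      also have "\<dots> \<le> gain \<alpha> \<rho> k (sample_path \<omega>) * g (x 0 \<omega>)"
        unfolding g_def using A1_V(3) A3_alpha(1) A1_rho(1)
        by (intro mult_left_mono gain_nonneg)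
      finally show "\<phi>\<^sub>1 (norm (x k \<omega>)) \<le> gain \<alpha> \<rho> k (sample_path \<omega>) * g (x 0 \<omega>)" .
    qed
    also have "\<dots> = ennreal (mean_gain \<alpha> \<rho> k * e)"
      unfolding e_def
      by (rule nn_integral_gain_indep[OF random indep g_meas g_nonneg g_int A3_alpha(1) A1_rho(1)])
    finally show ?thesis .
  qed
  have sums: "mean_gain \<alpha> \<rho> sums S" and \<Theta>_nonneg: "0 \<le> \<Theta>"
    unfolding S_def using mean_gain_sums[OF A2_irred A1_rho A3_alpha(1) Theta] .
  have "total_cost M \<phi>\<^sub>1 x \<le> (\<Sum>k. ennreal (mean_gain \<alpha> \<rho> k * e))"
    unfolding total_cost_def by (intro suminf_le term_le) auto
  also have "\<dots> = ennreal (S * e)"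
  proof (rule suminf_ennreal_eq)
    show "(\<lambda>k. mean_gain \<alpha> \<rho> k * e) sums (S * e)"
      by (rule sums_mult2[OF sums])
    show "0 \<le> mean_gain \<alpha> \<rho> k * e" for k
      unfolding mean_gain_def using e_nonneg A3_alpha(1) A1_rho(1)
      by (intro mult_nonneg_nonneg Bochner_Integration.integral_nonneg gain_nonneg)
  qed
  finally have cost: "total_cost M \<phi>\<^sub>1 x \<le> ennreal (S * e)" .

  have pos: "0 < (1 - \<Theta>) * (1 - \<rho>)"
    using Theta(2) A1_rho(2) by simp
  have S_le: "S \<le> B"
    unfolding S_def B_def using pos \<Theta>_nonneg by (intro divide_right_mono) auto
  have B_nonneg: "0 \<le> B"
    unfolding B_def using pos A3_alpha(1) A1_rho(2) by (intro divide_nonneg_nonneg) auto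
  have bound: "ennreal (B * e) = ennreal B * ennreal e"
    using B_nonneg e_nonneg by (simp add: ennreal_mult)
  have "total_cost M \<phi>\<^sub>1 x < \<infinity>"
    using cost by (rule le_less_trans) simp
  then have "stochastically_stable M x"
    using A1_phi(1) by (auto simp: stochastically_stable_def)
  moreover have "total_cost M \<phi>\<^sub>1 x \<le> ennreal B * ennreal e"
    using cost ennreal_leI[OF mult_right_mono[OF S_le e_nonneg]] by (simp add: bound[symmetric])
  moreover have "total_cost M \<phi>\<^sub>1 x < ennreal B * ennreal e"
    if \<Theta>_pos: "0 < \<Theta>" and nz: "\<not> (AE \<omega> in M. x 0 \<omega> = 0)"
  proof -
    have g_pos: "0 < g z" if "z \<noteq> 0" for z
    proof -
      have "\<phi>\<^sub>2 0 < \<phi>\<^sub>2 (norm z)"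
        using A1_phi(2) that strict_mono_onD[of "{0..}" \<phi>\<^sub>2 0 "norm z"]
        by (simp add: class_K_inf_def)
      then show ?thesis
        using A1_phi(2) by (simp add: class_K_inf_def g_def)
    qed
    have "e \<noteq> 0"
    proof
      assume "e = 0"
      then have "AE \<omega> in M. g (x 0 \<omega>) = 0"
        using integral_nonneg_eq_0_iff_AE[OF g_int] g_nonneg by (auto simp: e_def)
      then have "AE \<omega> in M. x 0 \<omega> = 0"
        by eventually_elim (use g_pos in fastforce)
      with nz show False ..
    qed
    with e_nonneg have e: "0 < e" by simp
    have "S < B"
      unfolding S_def B_def using pos \<Theta>_pos by (intro divide_strict_right_mono) auto
    moreover have "0 < B"
      unfolding B_def using pos A3_alpha(1) A1_rho(2) by (intro divide_pos_pos) auto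
    ultimately have "ennreal (S * e) < ennreal (B * e)"
      using e by (intro ennreal_lessI) auto
    with cost show ?thesis by (simp add: bound)
  qed
  ultimately show ?thesis
    unfolding moment B_def by blast
qed

end
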